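(* Let $R$ be a semiprime ring with $|\min(R)|<\infty$, let $\mathfrak{a}$ be an ideal of $R$ and $S\in\mathrm{Den}(R,\mathfrak{a})$. Suppose that for all $\mathfrak{p}\in\min(R,S)$, $\mathfrak{p}$ is a completely prime ideal of $R$ and $S^{-1}\mathfrak{p}$ is an ideal of $S^{-1}R$. Then: 1. The ring $S^{-1}R$ is a semiprime ring with $\min(S^{-1}R)=\{S^{-1}\mathfrak{p}\mid \mathfrak{p}\in\min(R,S)\}\subseteq \mathrm{Spec}_c(S^{-1}R)$. 2. In statement 1, all the ideals $S^{-1}\mathfrak{p}$ ($\mathfrak{p}\in\min(R,S)$) in the set $\min(S^{-1}R)$ are distinct, i.e. $|\min(S^{-1}R)|=|\min(R,S)|$.
   Context: Rings are associative with $1$; "ideal" means two-sided ideal. A multiplicative subset $S$ of $R$ is a multiplicative subsemigroup with $1\in S$, $0\notin S$. It is a left Ore set if $Sr\cap Rs\neq\emptyset$ for all $r\in R$, $s\in S$. A left Ore set $S$ is a left denominator set if $rs=0$ with $r\in R$, $s\in S$ implies $tr=0$ for some $t\in S$. Right Ore and right denominator sets are defined symmetrically; a denominator set is a left and right denominator set. $\mathrm{Den}(R,\mathfrak{a})$ is the set of (left and right) denominator sets $S$ of $R$ with $\mathrm{ass}(S)=\{r\in R\mid sr=0\text{ for some }s\in S\}=\mathfrak{a}$. $S^{-1}R=\{s^{-1}r\mid s\in S,r\in R\}$ is the localization and $S^{-1}\mathfrak{p}=\{s^{-1}p\mid s\in S,p\in\mathfrak{p}\}$. A ring is semiprime if the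 intersection of all its prime ideals is zero. $\min(R)$ is the set of minimal primes of $R$ and $\min(R,S)=\{\mathfrak{p}\in\min(R)\mid\mathfrak{p}\cap S=\emptyset\}$. An ideal $\mathfrak{p}$ of $R$ is completely prime if $R/\mathfrak{p}$ is a domain; $\mathrm{Spec}_c(R)$ is the set of completely prime ideals of $R$. *)

theory Defs
  imports "HOL-Algebra.Algebra"
begin

text \<open>Rings are not assumed commutative. The library's \<open>primeideal\<close> and \<open>domain\<close> presuppose a
  commutative ring, so their noncommutative counterparts are introduced here.\<close>

definition prime_ideal :: "('a, 'm) ring_scheme \<Rightarrow> 'a set \<Rightarrow> bool" where
  "prime_ideal R P \<longleftrightarrow> ideal P R \<and> P \<noteq> carrier R \<and>
     (\<forall>A B. ideal A R \<longrightarrow> ideal B R \<longrightarrow> ideal_prod R A B \<subseteq> P \<longrightarrow> A \<subseteq> P \<or> B \<subseteq> P)"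

definition min_primes :: "('a, 'm) ring_scheme \<Rightarrow> 'a set set" where
  "min_primes R = {P. prime_ideal R P \<and> (\<forall>Q. prime_ideal R Q \<longrightarrow> Q \<subseteq> P \<longrightarrow> Q = P)}"

text \<open>Intersecting with the carrier makes the empty intersection equal to the whole ring.\<close>

definition semiprime_ring :: "('a, 'm) ring_scheme \<Rightarrow> bool" where
  "semiprime_ring R \<longleftrightarrow> ring R \<and> carrier R \<inter> \<Inter> {P. prime_ideal R P} = {\<zero>\<^bsub>R\<^esub>}"

definition nc_domain :: "('a, 'm) ring_scheme \<Rightarrow> bool" where
  "nc_domain R \<longleftrightarrow> ring R \<and> \<one>\<^bsub>R\<^esub> \<noteq> \<zero>\<^bsub>R\<^esub> \<and>
     (\<forall>x\<in>carrier R. \<forall>y\<in>carrier R. x \<otimes>\<^bsub>R\<^esub> y = \<zero>\<^bsub>R\<^esub> \<longrightarrow> x = \<zero>\<^bsub>R\<^esub> \<or> y = \<zero>\<^bsub>R\<^esub>)"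

definition Spec_c :: "('a, 'm) ring_scheme \<Rightarrow> 'a set set" where
  "Spec_c R = {P. ideal P R \<and> nc_domain (R Quot P)}"

definition min_primes_avoiding :: "('a, 'm) ring_scheme \<Rightarrow> 'a set \<Rightarrow> 'a set set" where
  "min_primes_avoiding R S = {P \<in> min_primes R. P \<inter> S = {}}"

definition mult_subset :: "('a, 'm) ring_scheme \<Rightarrow> 'a set \<Rightarrow> bool" where
  "mult_subset R S \<longleftrightarrow> S \<subseteq> carrier R \<and> \<one>\<^bsub>R\<^esub> \<in> S \<and> \<zero>\<^bsub>R\<^esub> \<notin> S \<and>
     (\<forall>s\<in>S. \<forall>t\<in>S. s \<otimes>\<^bsub>R\<^esub> t \<in> S)"

definition left_Ore_set :: "('a, 'm) ring_scheme \<Rightarrow> 'a set \<Rightarrow> bool" where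
  "left_Ore_set R S \<longleftrightarrow> mult_subset R S \<and>
     (\<forall>r\<in>carrier R. \<forall>s\<in>S. \<exists>s'\<in>S. \<exists>r'\<in>carrier R. s' \<otimes>\<^bsub>R\<^esub> r = r' \<otimes>\<^bsub>R\<^esub> s)"

definition right_Ore_set :: "('a, 'm) ring_scheme \<Rightarrow> 'a set \<Rightarrow> bool" where
  "right_Ore_set R S \<longleftrightarrow> mult_subset R S \<and>
     (\<forall>r\<in>carrier R. \<forall>s\<in>S. \<exists>s'\<in>S. \<exists>r'\<in>carrier R. r \<otimes>\<^bsub>R\<^esub> s' = s \<otimes>\<^bsub>R\<^esub> r')"

definition left_denominator_set :: "('a, 'm) ring_scheme \<Rightarrow> 'a set \<Rightarrow> bool" where
  "left_denominator_set R S \<longleftrightarrow> left_Ore_set R S \<and>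
     (\<forall>r\<in>carrier R. \<forall>s\<in>S. r \<otimes>\<^bsub>R\<^esub> s = \<zero>\<^bsub>R\<^esub> \<longrightarrow> (\<exists>t\<in>S. t \<otimes>\<^bsub>R\<^esub> r = \<zero>\<^bsub>R\<^esub>))"

definition right_denominator_set :: "('a, 'm) ring_scheme \<Rightarrow> 'a set \<Rightarrow> bool" where
  "right_denominator_set R S \<longleftrightarrow> right_Ore_set R S \<and>
     (\<forall>r\<in>carrier R. \<forall>s\<in>S. s \<otimes>\<^bsub>R\<^esub> r = \<zero>\<^bsub>R\<^esub> \<longrightarrow> (\<exists>t\<in>S. r \<otimes>\<^bsub>R\<^esub> t = \<zero>\<^bsub>R\<^esub>))"

definition ass :: "('a, 'm) ring_scheme \<Rightarrow> 'a set \<Rightarrow> 'a set" where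
  "ass R S = {r \<in> carrier R. \<exists>s\<in>S. s \<otimes>\<^bsub>R\<^esub> r = \<zero>\<^bsub>R\<^esub>}"

definition Den :: "('a, 'm) ring_scheme \<Rightarrow> 'a set \<Rightarrow> 'a set set" where
  "Den R \<aa> = {S. left_denominator_set R S \<and> right_denominator_set R S \<and> ass R S = \<aa>}"

text \<open>For \<open>\<phi> : R \<rightarrow> Q\<close>, the set of left fractions \<open>s\<inverse>t\<close> with \<open>s \<in> S\<close>, \<open>t \<in> T\<close>; with \<open>Q = S\<inverse>R\<close> and
  \<open>T = \<pp>\<close> this is \<open>S\<inverse>\<pp>\<close>.\<close>

definition left_fractions ::
    "('b, 'n) ring_scheme \<Rightarrow> ('a \<Rightarrow> 'b) \<Rightarrow> 'a set \<Rightarrow> 'a set \<Rightarrow> 'b set" where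
  "left_fractions Q \<phi> S T = {inv\<^bsub>Q\<^esub> (\<phi> s) \<otimes>\<^bsub>Q\<^esub> \<phi> t | s t. s \<in> S \<and> t \<in> T}"

text \<open>The ring \<open>Q\<close>, with its canonical map \<open>\<phi> : R \<rightarrow> Q\<close>, is the localization \<open>S\<inverse>R\<close>. For a left
  denominator set \<open>S\<close> such a pair exists (Ore) and is unique up to a unique isomorphism under
  \<open>R\<close>; stating results for every such pair covers any construction of \<open>S\<inverse>R\<close>.\<close>

definition is_localization ::
    "('a, 'm) ring_scheme \<Rightarrow> 'a set \<Rightarrow> ('b, 'n) ring_scheme \<Rightarrow> ('a \<Rightarrow> 'b) \<Rightarrow> bool" where
  "is_localization R S Q \<phi> \<longleftrightarrow> ring Q \<and> \<phi> \<in> ring_hom R Q \<and> \<phi> ` S \<subseteq> Units Q \<and>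
     a_kernel R Q \<phi> = ass R S \<and> carrier Q = left_fractions Q \<phi> S (carrier R)"

end

theory Submission
  imports Defs
begin

text \<open>
  Localizing a completely prime \<open>\<pp>\<close> that avoids \<open>S\<close> and stays an ideal gives a completely prime ideal
  \<open>S\<inverse>\<pp>\<close> whose contraction to \<open>R\<close> is \<open>\<pp>\<close> again. Let \<open>r\<close> lie in every minimal prime avoiding \<open>S\<close>. Picking
  an element of \<open>S\<close> in each of the remaining, finitely many minimal primes and multiplying them gives
  \<open>s \<in> S\<close> such that \<open>s r\<close> lies in all minimal primes, so \<open>s r = 0\<close>. Hence the ideals \<open>S\<inverse>\<pp>\<close> intersect in
  zero, every prime of \<open>S\<inverse>R\<close> contains one of them, and they are pairwise incomparable because their
  contractions are.
\<close>

section \<open>Prime ideals in noncommutative rings\<close>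

context ring
begin

lemma Spec_c_iff:
  "P \<in> Spec_c R \<longleftrightarrow> ideal P R \<and> \<one> \<notin> P \<and>
     (\<forall>x\<in>carrier R. \<forall>y\<in>carrier R. x \<otimes> y \<in> P \<longrightarrow> x \<in> P \<or> y \<in> P)"
proof (cases "ideal P R")
  case True
  interpret I: ideal P R by fact
  have zero: "P +> x = P \<longleftrightarrow> x \<in> P" if "x \<in> carrier R" for x
    using that I.rcos_const_imp_mem I.a_rcos_const by blast
  have carr: "carrier (R Quot P) = (+>) P ` carrier R"
    by (auto simp: FactRing_simps)
  have mult: "(P +> x) \<otimes>\<^bsub>R Quot P\<^esub> (P +> y) = P +> (x \<otimes> y)"
    if "x \<in> carrier R" "y \<in> carrier R" for x y
    using that by (simp add: FactRing_def I.rcoset_mult_add)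
  have "\<one>\<^bsub>R Quot P\<^esub> = P +> \<one>" "\<zero>\<^bsub>R Quot P\<^esub> = P"
    by (simp_all add: FactRing_def)
  then show ?thesis
    using True I.quotient_is_ring
    by (simp add: Spec_c_def nc_domain_def carr mult zero)
qed (simp add: Spec_c_def)

text \<open>If neither factor lay in \<open>P\<close>, elements of \<open>A\<close> and
  \<open>B\<close> outside \<open>P\<close> would have their product in
  \<open>ideal_prod R A B\<close>, hence in \<open>P\<close>.\<close>

lemma Spec_c_imp_prime_ideal:
  assumes "P \<in> Spec_c R"
  shows "prime_ideal R P"
proof -
  have P: "ideal P R" "\<one> \<notin> P"
    and cp: "\<And>x y. \<lbrakk>x \<in> carrier R; y \<in> carrier R; x \<otimes> y \<in> P\<rbrakk> \<Longrightarrow> x \<in> P \<or> y \<in> P"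
    using assms by (auto simp: Spec_c_iff)
  have "A \<subseteq> P \<or> B \<subseteq> P" if A: "ideal A R" and B: "ideal B R" and AB: "ideal_prod R A B \<subseteq> P" for A B
  proof (rule ccontr)
    assume "\<not> ?thesis"
    then obtain a b where ab: "a \<in> A" "a \<notin> P" "b \<in> B" "b \<notin> P" by auto
    then have "a \<otimes> b \<in> P"
      using subsetD[OF AB ideal_prod.prod] by blast
    then show False
      using cp[of a b] ideal.Icarr[OF A ab(1)] ideal.Icarr[OF B ab(3)] ab by simp
  qed
  moreover have "P \<noteq> carrier R"
    using P(2) by auto
  ultimately show ?thesis
    using P(1) by (simp add: prime_ideal_def)
qed

section \<open>Minimal primes: existence, finite intersections, and those avoiding
  \<open>S\<close>\<close>

lemma prime_ideal_psubset:
  assumes "prime_ideal R P"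
  shows "P \<subset> carrier R"
proof -
  have "P \<subseteq> carrier R" "P \<noteq> carrier R"
    using assms ideal.Icarr[of P R] by (auto simp: prime_ideal_def)
  then show ?thesis
    by simp
qed

text \<open>If \<open>A\<close> is not inside \<open>P\<close> and \<open>B\<close> is not inside
  \<open>P'\<close>, the smaller of \<open>P\<close> and \<open>P'\<close> contains neither of them,
  which contradicts its primeness.\<close>

lemma prime_ideal_Inter_chain:
  assumes prime: "\<And>P. P \<in> C \<Longrightarrow> prime_ideal R P"
    and chain: "\<And>P Q. \<lbrakk>P \<in> C; Q \<in> C\<rbrakk> \<Longrightarrow> P \<subseteq> Q \<or> Q \<subseteq> P"
    and "C \<noteq> {}"
  shows "prime_ideal R (\<Inter>C)"
proof -
  have "ideal (\<Inter>C) R"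
    using assms by (intro i_Intersect) (auto simp: prime_ideal_def)
  moreover have "\<Inter>C \<noteq> carrier R"
  proof -
    obtain P where P: "P \<in> C" using \<open>C \<noteq> {}\<close> by blast
    then show ?thesis
      using prime_ideal_psubset[OF prime[OF P]] by blast
  qed
  moreover have "A \<subseteq> \<Inter>C \<or> B \<subseteq> \<Inter>C"
    if A: "ideal A R" and B: "ideal B R" and AB: "ideal_prod R A B \<subseteq> \<Inter>C" for A B
  proof (rule ccontr)
    assume "\<not> ?thesis"
    then obtain P P' where P: "P \<in> C" "\<not> A \<subseteq> P" "P' \<in> C" "\<not> B \<subseteq> P'"
      by (auto simp: le_Inf_iff)
    then obtain P'' where P'': "P'' \<in> C" "\<not> A \<subseteq> P''" "\<not> B \<subseteq> P''"
      using chain[of P P'] by (meson order_trans)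
    have "ideal_prod R A B \<subseteq> P''"
      using AB P''(1) by (simp add: le_Inf_iff)
    then show False
      using prime[OF P''(1)] A B P''(2,3) unfolding prime_ideal_def by blast
  qed
  ultimately show ?thesis
    by (simp add: prime_ideal_def)
qed

lemma prime_ideal_contains_min_prime:
  assumes "prime_ideal R P"
  obtains M where "M \<in> min_primes R" "M \<subseteq> P"
proof -
  \<comment> \<open>Zorn's lemma yields maximal elements, so it is applied to the complements.\<close>
  let ?A = "uminus ` {Q. prime_ideal R Q \<and> Q \<subseteq> P}"
  have "\<exists>M\<in>?A. \<forall>Y\<in>?A. M \<subseteq> Y \<longrightarrow> Y = M"
  proof (rule subset_Zorn_nonempty)
    show "?A \<noteq> {}"
      using assms by auto
  next
    fix C assume "C \<noteq> {}" and chain: "subset.chain ?A C"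
    \<comment> \<open>\<open>?D\<close> is the chain of primes whose complements form
      \<open>C\<close>; the complement of its intersection is the upper bound of
      \<open>C\<close>.\<close>
    let ?D = "uminus ` C"
    have D: "prime_ideal R Q" "Q \<subseteq> P" if "Q \<in> ?D" for Q
      using that chain by (auto simp: subset_chain_def)
    have "prime_ideal R (\<Inter>?D)"
    proof (rule prime_ideal_Inter_chain)
      fix Q Q' assume "Q \<in> ?D" "Q' \<in> ?D"
      then show "Q \<subseteq> Q' \<or> Q' \<subseteq> Q"
        using chain unfolding subset_chain_def by blast
    qed (use D \<open>C \<noteq> {}\<close> in auto)
    moreover have "\<Inter>?D \<subseteq> P"
      using D(2) \<open>C \<noteq> {}\<close> by blast
    moreover have "\<Union>C = - \<Inter>?D"
      by auto
    ultimately show "\<Union>C \<in> ?A"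
      by (intro image_eqI[of _ _ "\<Inter>?D"]) simp_all
  qed
  then obtain M where M: "prime_ideal R M" "M \<subseteq> P"
    and max: "\<forall>Y\<in>?A. - M \<subseteq> Y \<longrightarrow> Y = - M"
    by auto
  have "Q = M" if "prime_ideal R Q" "Q \<subseteq> M" for Q
  proof -
    have "- Q \<in> ?A"
      using that M(2) by blast
    then show ?thesis
      using bspec[OF max, of "- Q"] that(2) by simp
  qed
  then have "M \<in> min_primes R"
    using M(1) by (auto simp: min_primes_def)
  then show ?thesis
    using M(2) by (rule that)
qed

lemma semiprime_Inter_min_primes:
  assumes "semiprime_ring R"
  shows "carrier R \<inter> \<Inter>(min_primes R) = {\<zero>}"
proof -
  have "x \<in> P" if x: "x \<in> \<Inter>(min_primes R)" and P: "prime_ideal R P" for x P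
  proof -
    obtain M where "M \<in> min_primes R" "M \<subseteq> P"
      using P by (rule prime_ideal_contains_min_prime)
    then show ?thesis
      using x by blast
  qed
  then have "\<Inter>(min_primes R) = \<Inter>{P. prime_ideal R P}"
    by (auto simp: min_primes_def)
  then show ?thesis
    using assms by (simp add: semiprime_ring_def)
qed

text \<open>Induction on \<open>F\<close>: the product of \<open>I\<close> with the intersection of
  the remaining ideals lies in the intersection of both, hence in \<open>P\<close>, so primeness
  selects one of the two factors.\<close>

lemma prime_ideal_contains_factor:
  assumes "finite F" "\<And>I. I \<in> F \<Longrightarrow> ideal I R"
    and P: "prime_ideal R P" and "carrier R \<inter> \<Inter>F \<subseteq> P"
  shows "\<exists>I\<in>F. I \<subseteq> P"
  using assms(1,2,4)
proof (induction F)
  case empty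
  then show ?case
    using prime_ideal_psubset[OF P] by simp
next
  case (insert I F)
  let ?J = "carrier R \<inter> \<Inter>F"
  \<comment> \<open>Adjoining the whole ring makes the family nonempty, so \<open>?J\<close> is an
    ideal even for empty \<open>F\<close>.\<close>
  have "\<Inter>(insert (carrier R) F) = ?J"
    by simp
  then have J: "ideal ?J R"
    using insert.prems(1) oneideal by (metis i_Intersect insert_iff insert_not_empty)
  have I: "ideal I R"
    using insert.prems by simp
  have "ideal_prod R I ?J \<subseteq> P"
    using ideal_prod_inter[OF I J] insert.prems(2) by force
  then have "I \<subseteq> P \<or> ?J \<subseteq> P"
    using P I J by (simp add: prime_ideal_def)
  then show ?case
    using insert.IH insert.prems(1) by blast
qed

text \<open>Every prime contains the zero intersection and therefore a member of \<open>F\<close>. A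
  minimal prime must equal that member, and a member of \<open>F\<close> is minimal because
  \<open>F\<close> is an antichain.\<close>

lemma min_primes_eqI:
  assumes "finite F" "\<And>P. P \<in> F \<Longrightarrow> prime_ideal R P" "carrier R \<inter> \<Inter>F = {\<zero>}"
    and anti: "\<And>P Q. \<lbrakk>P \<in> F; Q \<in> F; P \<subseteq> Q\<rbrakk> \<Longrightarrow> P = Q"
  shows "min_primes R = F"
proof -
  have below: "\<exists>I\<in>F. I \<subseteq> P" if P: "prime_ideal R P" for P
  proof (rule prime_ideal_contains_factor)
    have "\<zero> \<in> P"
      using P by (simp add: prime_ideal_def additive_subgroup.zero_closed ideal.axioms(1))
    then show "carrier R \<inter> \<Inter>F \<subseteq> P"
      using assms(3) by simp
  qed (use assms(1,2) P in \<open>auto simp: prime_ideal_def\<close>)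
  show ?thesis
  proof (intro equalityI subsetI)
    fix P assume "P \<in> min_primes R"
    then show "P \<in> F"
      using below[of P] assms(2) by (auto simp: min_primes_def)
  next
    fix P assume P: "P \<in> F"
    have "Q = P" if "prime_ideal R Q" "Q \<subseteq> P" for Q
      using below[OF that(1)] anti P that(2) by blast
    then show "P \<in> min_primes R"
      using P assms(2) by (auto simp: min_primes_def)
  qed
qed

lemma Inter_primes_imp_semiprime:
  assumes "\<And>P. P \<in> F \<Longrightarrow> prime_ideal R P" "carrier R \<inter> \<Inter>F = {\<zero>}"
  shows "semiprime_ring R"
proof -
  have "\<zero> \<in> P" if "prime_ideal R P" for P
    using that by (simp add: prime_ideal_def additive_subgroup.zero_closed ideal.axioms(1))
  moreover have "carrier R \<inter> \<Inter>{P. prime_ideal R P} \<subseteq> carrier R \<inter> \<Inter>F"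
    using assms(1) by auto
  ultimately show ?thesis
    using assms(2) ring_axioms unfolding semiprime_ring_def by auto
qed

text \<open>The witness is a product of elements of \<open>S\<close>, one from each member of
  \<open>F\<close>; two-sided ideals absorb the other factors. The empty product is
  \<open>\<one>\<close>.\<close>

lemma mult_subset_meets_Inter:
  assumes S: "mult_subset R S" and "finite F"
    and "\<And>I. I \<in> F \<Longrightarrow> ideal I R" "\<And>I. I \<in> F \<Longrightarrow> I \<inter> S \<noteq> {}"
  shows "\<exists>s\<in>S. \<forall>I\<in>F. s \<in> I"
  using assms(2-)
proof (induction F)
  case empty
  then show ?case
    using S by (auto simp: mult_subset_def)
next
  case (insert I F)
  then obtain s where s: "s \<in> S" "\<forall>J\<in>F. s \<in> J"
    by auto
  obtain t where t: "t \<in> S" "t \<in> I"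
    using insert.prems(2) by blast
  have carr: "s \<in> carrier R" "t \<in> carrier R"
    using s t S by (auto simp: mult_subset_def)
  have "\<forall>J\<in>insert I F. s \<otimes> t \<in> J"
    using s t carr insert.prems(1) by (auto intro: ideal.I_l_closed ideal.I_r_closed)
  moreover have "s \<otimes> t \<in> S"
    using s t S by (auto simp: mult_subset_def)
  ultimately show ?case ..
qed

lemma semiprime_min_primes_avoiding_ass:
  assumes "semiprime_ring R" "finite (min_primes R)" "mult_subset R S"
    and r: "r \<in> carrier R" "\<And>P. P \<in> min_primes_avoiding R S \<Longrightarrow> r \<in> P"
  shows "r \<in> ass R S"
proof -
  have min_ideal: "ideal P R" if "P \<in> min_primes R" for P
    using that by (simp add: min_primes_def prime_ideal_def)
  have "\<exists>s\<in>S. \<forall>P\<in>{P \<in> min_primes R. P \<inter> S \<noteq> {}}. s \<in> P"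
    using assms(2) min_ideal by (intro mult_subset_meets_Inter[OF assms(3)]) simp_all
  then obtain s where s: "s \<in> S" "\<And>P. \<lbrakk>P \<in> min_primes R; P \<inter> S \<noteq> {}\<rbrakk> \<Longrightarrow> s \<in> P"
    by blast
  have sc: "s \<in> carrier R"
    using s(1) assms(3) by (auto simp: mult_subset_def)
  \<comment> \<open>A minimal prime avoiding \<open>S\<close> contains \<open>r\<close>, and any
    other contains \<open>s\<close>.\<close>
  have "s \<otimes> r \<in> P" if P: "P \<in> min_primes R" for P
  proof (cases "P \<inter> S = {}")
    case True
    then have "r \<in> P"
      using P r(2) by (simp add: min_primes_avoiding_def)
    then show ?thesis
      using ideal.I_l_closed[OF min_ideal[OF P]] sc by blast
  next
    case False
    then show ?thesis
      using ideal.I_r_closed[OF min_ideal[OF P]] s(2) P r(1) by blast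
  qed
  then have "s \<otimes> r = \<zero>"
    using semiprime_Inter_min_primes[OF assms(1)] sc r(1) by blast
  then show ?thesis
    using s(1) r(1) by (auto simp: ass_def)
qed

end

section \<open>Localization at a left Ore set\<close>

text \<open>Facts qualified by \<open>S.\<close> concern the target ring \<open>Q\<close>; the set
  \<open>S\<close> of denominators only shares the letter.\<close>

locale left_localization = ring_hom_ring R Q \<phi>
  for R :: "('a, 'm) ring_scheme" (structure) and Q :: "('b, 'n) ring_scheme" (structure)
    and \<phi> :: "'a \<Rightarrow> 'b" +
  fixes S :: "'a set"
  assumes left_Ore: "left_Ore_set R S"
    and localization: "is_localization R S Q \<phi>"
begin

section \<open>Left fractions, and extension and contraction of ideals\<close>

lemma mult_subset: "mult_subset R S"
  using left_Ore by (simp add: left_Ore_set_def)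

lemma S_carrier: "s \<in> S \<Longrightarrow> s \<in> carrier R"
  using mult_subset by (auto simp: mult_subset_def)

lemma hom_Units: "s \<in> S \<Longrightarrow> \<phi> s \<in> Units Q"
  using localization by (auto simp: is_localization_def)

lemma inv_hom_closed: "s \<in> S \<Longrightarrow> inv\<^bsub>Q\<^esub> (\<phi> s) \<in> carrier Q"
  by (simp add: hom_Units)

lemma hom_eq_zero_iff: "r \<in> carrier R \<Longrightarrow> \<phi> r = \<zero>\<^bsub>Q\<^esub> \<longleftrightarrow> r \<in> ass R S"
  using localization unfolding is_localization_def a_kernel_def' by blast

lemma fraction:
  assumes "x \<in> carrier Q"
  obtains s r where "s \<in> S" "r \<in> carrier R" "x = inv\<^bsub>Q\<^esub> (\<phi> s) \<otimes>\<^bsub>Q\<^esub> \<phi> r"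
  using assms localization by (auto simp: is_localization_def left_fractions_def)

lemma hom_in_left_fractions:
  assumes "T \<subseteq> carrier R" "t \<in> T"
  shows "\<phi> t \<in> left_fractions Q \<phi> S T"
proof -
  have "inv\<^bsub>Q\<^esub> (\<phi> \<one>) \<otimes>\<^bsub>Q\<^esub> \<phi> t = \<phi> t" "\<one> \<in> S"
    using assms mult_subset by (auto simp: mult_subset_def)
  then show ?thesis
    using assms(2) unfolding left_fractions_def by (metis (mono_tags, lifting) mem_Collect_eq)
qed

lemma inv_mult_cancel:
  assumes "s \<in> S" "x \<in> carrier Q"
  shows "\<phi> s \<otimes>\<^bsub>Q\<^esub> (inv\<^bsub>Q\<^esub> (\<phi> s) \<otimes>\<^bsub>Q\<^esub> x) = x"
  using assms hom_Units[OF assms(1)] S.Units_closed S.Units_inv_closed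
  by (simp flip: S.m_assoc)

text \<open>Since \<open>\<phi> s\<close> is a unit, multiplying by it undoes the fraction;
  membership in an ideal of \<open>Q\<close> thus depends on numerators only.\<close>

lemma fraction_mem_iff:
  assumes I: "ideal I Q" and s: "s \<in> S" and x: "x \<in> carrier Q"
  shows "inv\<^bsub>Q\<^esub> (\<phi> s) \<otimes>\<^bsub>Q\<^esub> x \<in> I \<longleftrightarrow> x \<in> I"
proof
  assume "inv\<^bsub>Q\<^esub> (\<phi> s) \<otimes>\<^bsub>Q\<^esub> x \<in> I"
  then have "\<phi> s \<otimes>\<^bsub>Q\<^esub> (inv\<^bsub>Q\<^esub> (\<phi> s) \<otimes>\<^bsub>Q\<^esub> x) \<in> I"
    using I s by (simp add: ideal.I_l_closed S_carrier)
  then show "x \<in> I"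
    using s x by (simp add: inv_mult_cancel)
qed (use I s in \<open>simp add: ideal.I_l_closed inv_hom_closed\<close>)

text \<open>Moves a denominator from the right of a numerator to its left, as needed to multiply two
  left fractions. It is the image of \<open>s' \<otimes> r = r' \<otimes> s\<close> multiplied by
  the inverses on both sides.\<close>

lemma Ore_swap:
  assumes "r \<in> carrier R" "s \<in> S"
  obtains s' r' where "s' \<in> S" "r' \<in> carrier R"
    "\<phi> r \<otimes>\<^bsub>Q\<^esub> inv\<^bsub>Q\<^esub> (\<phi> s) = inv\<^bsub>Q\<^esub> (\<phi> s') \<otimes>\<^bsub>Q\<^esub> \<phi> r'"
proof -
  obtain s' r' where *: "s' \<in> S" "r' \<in> carrier R" "s' \<otimes> r = r' \<otimes> s"
    using left_Ore assms unfolding left_Ore_set_def by blast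
  note u = hom_Units[OF assms(2)] hom_Units[OF *(1)]
  note c = S_carrier[OF assms(2)] S_carrier[OF *(1)]
  have eq: "\<phi> s' \<otimes>\<^bsub>Q\<^esub> \<phi> r = \<phi> r' \<otimes>\<^bsub>Q\<^esub> \<phi> s"
    using *(2,3) assms(1) c by (metis hom_mult)
  have "\<phi> r = inv\<^bsub>Q\<^esub> (\<phi> s') \<otimes>\<^bsub>Q\<^esub> (\<phi> s' \<otimes>\<^bsub>Q\<^esub> \<phi> r)"
    using u c assms(1) by (simp flip: S.m_assoc)
  also have "\<dots> = inv\<^bsub>Q\<^esub> (\<phi> s') \<otimes>\<^bsub>Q\<^esub> \<phi> r' \<otimes>\<^bsub>Q\<^esub> \<phi> s"
    using u c *(2) by (simp add: eq S.m_assoc)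
  finally have "\<phi> r \<otimes>\<^bsub>Q\<^esub> inv\<^bsub>Q\<^esub> (\<phi> s) = inv\<^bsub>Q\<^esub> (\<phi> s') \<otimes>\<^bsub>Q\<^esub> \<phi> r'"
    using u c *(2) by (simp add: S.m_assoc)
  with * show ?thesis
    using that by blast
qed

text \<open>Contracting the extension of \<open>P\<close> gives back \<open>P\<close>. An equality
  of fractions holds in \<open>R\<close> only up to \<open>ass R S\<close>, so some \<open>u\<close>
  in \<open>S\<close> must clear the error; then \<open>u \<otimes> s\<close> lies in
  \<open>S\<close>, hence outside \<open>P\<close>, and complete primeness cancels it.\<close>

lemma hom_in_left_fractions_iff:
  assumes P: "P \<in> Spec_c R" "P \<inter> S = {}" and r: "r \<in> carrier R"
  shows "\<phi> r \<in> left_fractions Q \<phi> S P \<longleftrightarrow> r \<in> P"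
proof
  interpret P: ideal P R
    using P(1) by (simp add: Spec_c_def)
  have cp: "x \<in> carrier R \<Longrightarrow> y \<in> carrier R \<Longrightarrow> x \<otimes> y \<in> P \<Longrightarrow> x \<in> P \<or> y \<in> P" for x y
    using P(1) by (simp add: R.Spec_c_iff)
  assume "\<phi> r \<in> left_fractions Q \<phi> S P"
  then obtain s p where sp: "s \<in> S" "p \<in> P" "\<phi> r = inv\<^bsub>Q\<^esub> (\<phi> s) \<otimes>\<^bsub>Q\<^esub> \<phi> p"
    by (auto simp: left_fractions_def)
  have sc: "s \<in> carrier R" and pc: "p \<in> carrier R"
    using sp by (auto simp: S_carrier)
  have "\<phi> s \<otimes>\<^bsub>Q\<^esub> \<phi> r = \<phi> p"
    using sp pc by (simp add: inv_mult_cancel)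
  then have "\<phi> (s \<otimes> r \<ominus> p) = \<zero>\<^bsub>Q\<^esub>"
    using sc pc r by (simp add: R.minus_eq S.r_neg)
  then have "s \<otimes> r \<ominus> p \<in> ass R S"
    using sc pc r by (simp add: hom_eq_zero_iff)
  then obtain u where u: "u \<in> S" "u \<otimes> (s \<otimes> r \<ominus> p) = \<zero>"
    by (auto simp: ass_def)
  have uc: "u \<in> carrier R"
    using u by (simp add: S_carrier)
  have "u \<otimes> s \<otimes> r = u \<otimes> (s \<otimes> r \<ominus> p) \<oplus> u \<otimes> p"
    using uc sc pc r by algebra
  then have "u \<otimes> s \<otimes> r \<in> P"
    using u uc pc sp(2) by (simp add: P.I_l_closed)
  moreover have "u \<otimes> s \<in> S"
    using u sp mult_subset by (auto simp: mult_subset_def)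
  ultimately show "r \<in> P"
    using cp[of "u \<otimes> s" r] uc sc r P(2) by auto
next
  assume "r \<in> P"
  moreover have "P \<subseteq> carrier R"
    using P(1) ideal.Icarr by (auto simp: Spec_c_def)
  ultimately show "\<phi> r \<in> left_fractions Q \<phi> S P"
    by (rule hom_in_left_fractions[rotated])
qed

lemma left_fractions_subset_iff:
  assumes "P \<in> Spec_c R" "P \<inter> S = {}" "P' \<in> Spec_c R" "P' \<inter> S = {}"
  shows "left_fractions Q \<phi> S P \<subseteq> left_fractions Q \<phi> S P' \<longleftrightarrow> P \<subseteq> P'"
proof
  assume sub: "left_fractions Q \<phi> S P \<subseteq> left_fractions Q \<phi> S P'"
  show "P \<subseteq> P'"
  proof
    fix r assume r: "r \<in> P"
    then have "r \<in> carrier R"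
      using assms(1) ideal.Icarr by (auto simp: Spec_c_def)
    then show "r \<in> P'"
      using r sub assms hom_in_left_fractions_iff by blast
  qed
qed (auto simp: left_fractions_def)

text \<open>Swapping the inner denominator turns the product of two fractions into a fraction with
  numerator \<open>c \<otimes> b\<close>. Stripping denominators and contracting puts this numerator
  in \<open>P\<close>, where complete primeness applies.\<close>

lemma left_fractions_Spec_c:
  assumes P: "P \<in> Spec_c R" "P \<inter> S = {}" and I: "ideal (left_fractions Q \<phi> S P) Q"
  shows "left_fractions Q \<phi> S P \<in> Spec_c Q"
proof -
  let ?I = "left_fractions Q \<phi> S P"
  have P': "\<one> \<notin> P" "\<And>x y. \<lbrakk>x \<in> carrier R; y \<in> carrier R; x \<otimes> y \<in> P\<rbrakk> \<Longrightarrow> x \<in> P \<or> y \<in> P"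
    using P(1) by (auto simp: R.Spec_c_iff)
  note contr = hom_in_left_fractions_iff[OF P]
  have "\<one>\<^bsub>Q\<^esub> \<notin> ?I"
    using contr[OF R.one_closed] P'(1) by simp
  moreover have "x \<in> ?I \<or> y \<in> ?I"
    if x: "x \<in> carrier Q" and y: "y \<in> carrier Q" and xy: "x \<otimes>\<^bsub>Q\<^esub> y \<in> ?I" for x y
  proof -
    obtain s a where a: "s \<in> S" "a \<in> carrier R" "x = inv\<^bsub>Q\<^esub> (\<phi> s) \<otimes>\<^bsub>Q\<^esub> \<phi> a"
      using x by (rule fraction)
    obtain t b where b: "t \<in> S" "b \<in> carrier R" "y = inv\<^bsub>Q\<^esub> (\<phi> t) \<otimes>\<^bsub>Q\<^esub> \<phi> b"
      using y by (rule fraction)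
    obtain u c where c: "u \<in> S" "c \<in> carrier R"
      "\<phi> a \<otimes>\<^bsub>Q\<^esub> inv\<^bsub>Q\<^esub> (\<phi> t) = inv\<^bsub>Q\<^esub> (\<phi> u) \<otimes>\<^bsub>Q\<^esub> \<phi> c"
      using a(2) b(1) by (rule Ore_swap)
    note inv = a(1)[THEN inv_hom_closed] b(1)[THEN inv_hom_closed] c(1)[THEN inv_hom_closed]
    have "x \<otimes>\<^bsub>Q\<^esub> y = inv\<^bsub>Q\<^esub> (\<phi> s) \<otimes>\<^bsub>Q\<^esub> ((\<phi> a \<otimes>\<^bsub>Q\<^esub> inv\<^bsub>Q\<^esub> (\<phi> t)) \<otimes>\<^bsub>Q\<^esub> \<phi> b)"
      using a b inv by (simp add: S.m_assoc)
    also have "\<dots> = inv\<^bsub>Q\<^esub> (\<phi> s) \<otimes>\<^bsub>Q\<^esub> (inv\<^bsub>Q\<^esub> (\<phi> u) \<otimes>\<^bsub>Q\<^esub> \<phi> (c \<otimes> b))"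
      using b c inv by (simp add: c(3) S.m_assoc)
    finally have "\<phi> (c \<otimes> b) \<in> ?I"
      using xy a(1) b c inv by (simp add: fraction_mem_iff[OF I] del: hom_mult)
    then have "c \<in> P \<or> b \<in> P"
      using contr P'(2) b(2) c(2) by blast
    then show ?thesis
    proof
      assume "c \<in> P"
      then have "\<phi> a \<otimes>\<^bsub>Q\<^esub> inv\<^bsub>Q\<^esub> (\<phi> t) \<in> ?I"
        using c contr by (simp add: fraction_mem_iff[OF I])
      \<comment> \<open>Absorption on the right removes the denominator introduced by
        \<open>y\<close>, leaving the numerator of \<open>x\<close>.\<close>
      then have "\<phi> a \<otimes>\<^bsub>Q\<^esub> inv\<^bsub>Q\<^esub> (\<phi> t) \<otimes>\<^bsub>Q\<^esub> \<phi> t \<in> ?I"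
        using b(1) by (simp add: ideal.I_r_closed[OF I] S_carrier)
      then have "\<phi> a \<in> ?I"
        using a(2) b(1) by (simp add: S.m_assoc hom_Units S_carrier)
      then show ?thesis
        using a by (simp add: fraction_mem_iff[OF I])
    next
      assume "b \<in> P"
      then show ?thesis
        using b contr by (simp add: fraction_mem_iff[OF I])
    qed
  qed
  ultimately show ?thesis
    using I by (simp add: S.Spec_c_iff)
qed

text \<open>The numerator of a common element lies in every \<open>P\<close> by contraction, hence
  in \<open>ass R S\<close>, and \<open>\<phi>\<close> sends it to zero.\<close>

lemma Inter_left_fractions_eq_zero:
  assumes F: "\<And>P. P \<in> F \<Longrightarrow> P \<in> Spec_c R" "\<And>P. P \<in> F \<Longrightarrow> P \<inter> S = {}"
    "\<And>P. P \<in> F \<Longrightarrow> ideal (left_fractions Q \<phi> S P) Q"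
    and ass: "carrier R \<inter> \<Inter>F \<subseteq> ass R S"
  shows "carrier Q \<inter> \<Inter>(left_fractions Q \<phi> S ` F) = {\<zero>\<^bsub>Q\<^esub>}"
proof -
  have "x = \<zero>\<^bsub>Q\<^esub>" if x: "x \<in> carrier Q" "\<And>P. P \<in> F \<Longrightarrow> x \<in> left_fractions Q \<phi> S P" for x
  proof -
    obtain s r where r: "s \<in> S" "r \<in> carrier R" "x = inv\<^bsub>Q\<^esub> (\<phi> s) \<otimes>\<^bsub>Q\<^esub> \<phi> r"
      using x(1) by (rule fraction)
    have "r \<in> P" if P: "P \<in> F" for P
      using x(2)[OF P] r fraction_mem_iff[OF F(3)[OF P]] F(1,2)[OF P]
      by (simp add: hom_in_left_fractions_iff)
    then have "\<phi> r = \<zero>\<^bsub>Q\<^esub>"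
      using ass r(2) hom_eq_zero_iff by auto
    then show ?thesis
      using r by (simp add: inv_hom_closed)
  qed
  moreover have "\<zero>\<^bsub>Q\<^esub> \<in> left_fractions Q \<phi> S P" if "P \<in> F" for P
    using F(3)[OF that] by (simp add: additive_subgroup.zero_closed ideal.axioms(1))
  ultimately show ?thesis
    by auto
qed

end

section \<open>The minimal primes of the localization\<close>

theorem proposition1p5:
  fixes R :: "('a, 'm) ring_scheme" and Q :: "('b, 'n) ring_scheme"
    and \<aa> S :: "'a set" and \<phi> :: "'a \<Rightarrow> 'b"
  assumes "semiprime_ring R"
    and "finite (min_primes R)"
    and "ideal \<aa> R"
    and "S \<in> Den R \<aa>"
    and "is_localization R S Q \<phi>"
    and "\<And>\<pp>. \<pp> \<in> min_primes_avoiding R S \<Longrightarrow>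
           \<pp> \<in> Spec_c R \<and> ideal (left_fractions Q \<phi> S \<pp>) Q"
  shows "semiprime_ring Q \<and>
         min_primes Q = {left_fractions Q \<phi> S \<pp> | \<pp>. \<pp> \<in> min_primes_avoiding R S} \<and>
         min_primes Q \<subseteq> Spec_c Q \<and>
         inj_on (left_fractions Q \<phi> S) (min_primes_avoiding R S) \<and>
         card (min_primes Q) = card (min_primes_avoiding R S)"
proof -
  interpret R: ring R
    using assms(1) by (simp add: semiprime_ring_def)
  interpret Q: ring Q
    using assms(5) by (simp add: is_localization_def)
  interpret hom: ring_hom_ring R Q \<phi>
    using assms(5) by unfold_locales (simp add: is_localization_def)
  interpret left_localization R Q \<phi> S
    using assms(4,5) by unfold_locales (simp_all add: Den_def left_denominator_set_def)
  let ?M = "min_primes_avoiding R S"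
  let ?L = "left_fractions Q \<phi> S"
  have M: "P \<in> Spec_c R" "P \<inter> S = {}" "ideal (?L P) Q" if "P \<in> ?M" for P
    using that assms(6)[OF that] by (auto simp: min_primes_avoiding_def)
  \<comment> \<open>Contraction gives \<open>P \<subseteq> P'\<close>, and \<open>P'\<close> is
    minimal. This one fact yields both the injectivity of \<open>?L\<close> on \<open>?M\<close> and
    the antichain property of the extensions.\<close>
  have min: "P = P'" if "P \<in> ?M" "P' \<in> ?M" "?L P \<subseteq> ?L P'" for P P'
  proof -
    have "P \<subseteq> P'"
      using that left_fractions_subset_iff M by blast
    then show ?thesis
      using that(1,2) by (auto simp: min_primes_avoiding_def min_primes_def)
  qed
  have inj: "inj_on ?L ?M"
    using min by (intro inj_onI) simp
  have Spec: "?L ` ?M \<subseteq> Spec_c Q"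
    using left_fractions_Spec_c M by blast
  then have prime: "prime_ideal Q I" if "I \<in> ?L ` ?M" for I
    using that Q.Spec_c_imp_prime_ideal by blast
  \<comment> \<open>Semiprimeness of \<open>R\<close> and finiteness of \<open>min_primes R\<close>
    enter here, placing the intersection of \<open>?M\<close> inside \<open>ass R S\<close>.\<close>
  have zero: "carrier Q \<inter> \<Inter>(?L ` ?M) = {\<zero>\<^bsub>Q\<^esub>}"
    using M R.semiprime_min_primes_avoiding_ass[OF assms(1,2) mult_subset]
    by (intro Inter_left_fractions_eq_zero) auto
  have minQ: "min_primes Q = ?L ` ?M"
  proof (rule Q.min_primes_eqI)
    show "finite (?L ` ?M)"
      using assms(2) by (simp add: min_primes_avoiding_def)
    fix I J assume "I \<in> ?L ` ?M" "J \<in> ?L ` ?M" "I \<subseteq> J"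
    then obtain P P' where "P \<in> ?M" "P' \<in> ?M" "I = ?L P" "J = ?L P'"
      by blast
    then show "I = J"
      using min[of P P'] \<open>I \<subseteq> J\<close> by simp
  qed (use prime zero in auto)
  moreover have "semiprime_ring Q"
    using prime zero by (rule Q.Inter_primes_imp_semiprime)
  ultimately show ?thesis
    using Spec inj by (auto simp: card_image)
qed

end
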